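(* For every finite alphabet $\Lambda$ and every $\varepsilon>0$ there is $\delta>0$ such that if $\mathbf{X}=(X_i)_{i=0}^\infty$ and $\mathbf{X}'=(X'_i)_{i=0}^\infty$ are $\Lambda$-valued stationary processes with $\bar d_{\mathcal{M}}(\mathbf{X},\mathbf{X}')<\delta$, then $|\bar H(\mathbf{X})-\bar H(\mathbf{X}')|<\varepsilon$.
   Context: No ergodicity is assumed. Entropy rate: for a stationary $\Lambda$-valued process $\mathbf{Z}=(Z_i)_{i=0}^\infty$ with law $\nu$, $$\bar H(\mathbf{Z})=\lim_{n\to\infty}\frac1n\sum_{\lambda_1\ldots\lambda_n\in\Lambda^n}\eta\big(\nu(Z_0=\lambda_1,\ldots,Z_{n-1}=\lambda_n)\big),$$ where $\eta(0)=0$ and $\eta(t)=-t\log t$ for $t>0$ (the base of the logarithm is fixed). The limit exists. Ornstein's metric $\bar d_{\mathcal{M}}$ between stationary processes: let $\mu$ and $\mu'$ be the shift-invariant probability measures on $\Lambda^{\mathbb{N}_0}$ that are the distributions of $\mathbf{X}$ and $\mathbf{X}'$. A stationary joining of $\mathbf{X}$ and $\mathbf{X}'$ is a probability measure $\xi$ on $\Lambda^{\mathbb{N}_0}\times\Lambda^{\mathbb{N}_0}$ that is invariant under $\sigma\times\sigma$ (with $\sigma$ the left shift) and has marginals $\mu$ and $\mu'$. Then $$\bar d_{\mathcal{M}}(\mathbf{X},\mathbf{X}')=\inf_{\xi}\ \xi\big(\{(x,x'):x_0\neq x'_0\}\big),$$ where the infimum is over all stationary joinings $\xi$ of $\mathbf{X}$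 and $\mathbf{X}'$. *)

theory Defs
  imports "HOL-Probability.Probability"
begin

definition seq_space :: "(nat \<Rightarrow> 'a) measure" where
  "seq_space = PiM UNIV (\<lambda>_. count_space UNIV)"

definition left_shift :: "(nat \<Rightarrow> 'a) \<Rightarrow> (nat \<Rightarrow> 'a)" where
  "left_shift x = (\<lambda>i. x (Suc i))"

definition process_law :: "'w measure \<Rightarrow> (nat \<Rightarrow> 'w \<Rightarrow> 'a) \<Rightarrow> (nat \<Rightarrow> 'a) measure" where
  "process_law M X = distr M seq_space (\<lambda>\<omega> i. X i \<omega>)"

definition stationary_process :: "'w measure \<Rightarrow> (nat \<Rightarrow> 'w \<Rightarrow> 'a) \<Rightarrow> bool" where
  "stationary_process M X \<longleftrightarrow>
     prob_space M \<and> (\<forall>i. X i \<in> measurable M (count_space UNIV)) \<and>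
     process_law M (\<lambda>i. X (Suc i)) = process_law M X"

text \<open>
  The entropy rate and the distance \<open>d_bar\<close> depend on a process only through its law, so
  both are defined on laws. A statement about all pairs of laws is then
  uniform in the sample spaces, over whose types HOL cannot quantify inside a formula.
  The lemmas \<open>stationary_law_process_law\<close> and \<open>stationary_law_coordinate_process\<close>
  show that the stationary laws are exactly the laws of stationary processes.
\<close>

definition stationary_law :: "(nat \<Rightarrow> 'a) measure \<Rightarrow> bool" where
  "stationary_law \<mu> \<longleftrightarrow>
     prob_space \<mu> \<and> sets \<mu> = sets seq_space \<and> distr \<mu> seq_space left_shift = \<mu>"

definition eta :: "real \<Rightarrow> real \<Rightarrow> real" where
  "eta b t = (if t = 0 then 0 else - t * log b t)"

text \<open>The parameter \<open>b\<close> is the base of the logarithm; words are lists.\<close>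

definition entropy_rate :: "real \<Rightarrow> (nat \<Rightarrow> 'a::finite) measure \<Rightarrow> real" where
  "entropy_rate b \<nu> =
     lim (\<lambda>n. (1 / real n) *
       (\<Sum>w\<in>{w. length w = n}. eta b (measure \<nu> {x. \<forall>i<n. x i = w ! i})))"

definition stationary_joining ::
  "(nat \<Rightarrow> 'a) measure \<Rightarrow> (nat \<Rightarrow> 'a) measure \<Rightarrow> ((nat \<Rightarrow> 'a) \<times> (nat \<Rightarrow> 'a)) measure \<Rightarrow> bool" where
  "stationary_joining \<mu> \<mu>' \<xi> \<longleftrightarrow>
     prob_space \<xi> \<and> sets \<xi> = sets (seq_space \<Otimes>\<^sub>M seq_space) \<and>
     distr \<xi> (seq_space \<Otimes>\<^sub>M seq_space) (map_prod left_shift left_shift) = \<xi> \<and>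
     distr \<xi> seq_space fst = \<mu> \<and> distr \<xi> seq_space snd = \<mu>'"

text \<open>
  For stationary laws the infimum is over a nonempty set of nonnegative reals
  (see \<open>stationary_joining_pair_measure\<close> below).
\<close>

definition d_bar :: "(nat \<Rightarrow> 'a) measure \<Rightarrow> (nat \<Rightarrow> 'a) measure \<Rightarrow> real" where
  "d_bar \<mu> \<mu>' = (INF \<xi>\<in>{\<xi>. stationary_joining \<mu> \<mu>' \<xi>}. measure \<xi> {(x, x'). x 0 \<noteq> x' 0})"

lemma space_seq_space [simp]: "space seq_space = UNIV"
  by (simp add: seq_space_def space_PiM)

lemma measurable_seq_space:
  assumes "\<And>i. (\<lambda>\<omega>. f \<omega> i) \<in> measurable M (count_space UNIV)"
  shows "f \<in> measurable M seq_space"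
  unfolding seq_space_def by (rule measurable_PiM_single') (use assms in auto)

lemma measurable_coord: "(\<lambda>x. x i) \<in> measurable seq_space (count_space UNIV)"
  unfolding seq_space_def by (rule measurable_component_singleton) simp

lemma measurable_shift: "left_shift \<in> measurable seq_space seq_space"
  by (rule measurable_seq_space) (simp add: left_shift_def measurable_coord)

lemma stationary_law_process_law:
  assumes "stationary_process M X"
  shows "stationary_law (process_law M X)"
proof -
  have X: "X i \<in> measurable M (count_space UNIV)" for i
    using assms by (simp add: stationary_process_def)
  have m: "(\<lambda>\<omega> i. X i \<omega>) \<in> measurable M seq_space"
    by (rule measurable_seq_space) (rule X)
  have "distr (process_law M X) seq_space left_shift = process_law M (\<lambda>i. X (Suc i))"
    unfolding process_law_def
    by (subst distr_distr[OF measurable_shift m]) (simp add: left_shift_def comp_def)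
  then show ?thesis
    using assms m unfolding stationary_law_def stationary_process_def
    by (auto simp: process_law_def intro: prob_space.prob_space_distr)
qed

lemma stationary_law_coordinate_process:
  assumes "stationary_law \<mu>"
  shows "stationary_process \<mu> (\<lambda>i x. x i)" and "process_law \<mu> (\<lambda>i x. x i) = \<mu>"
proof -
  have s: "sets \<mu> = sets seq_space" using assms by (simp add: stationary_law_def)
  show law: "process_law \<mu> (\<lambda>i x. x i) = \<mu>"
    unfolding process_law_def by (rule distr_id2[OF s[symmetric], unfolded id_def])
  have "process_law \<mu> (\<lambda>i x. x (Suc i)) = \<mu>"
    using assms by (simp add: process_law_def stationary_law_def left_shift_def[abs_def])
  moreover have "(\<lambda>x. x i) \<in> measurable \<mu> (count_space UNIV)" for i
    unfolding measurable_cong_sets[OF s refl] by (rule measurable_coord)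
  ultimately show "stationary_process \<mu> (\<lambda>i x. x i)"
    using assms law by (simp add: stationary_process_def stationary_law_def)
qed

lemma stationary_joining_pair_measure:
  assumes "stationary_law \<mu>" and "stationary_law \<mu>'"
  shows "stationary_joining \<mu> \<mu>' (\<mu> \<Otimes>\<^sub>M \<mu>')"
proof -
  have s: "sets \<mu> = sets seq_space" "sets \<mu>' = sets seq_space"
    and d: "distr \<mu> seq_space left_shift = \<mu>" "distr \<mu>' seq_space left_shift = \<mu>'"
    using assms by (auto simp: stationary_law_def)
  interpret A: prob_space \<mu> using assms by (simp add: stationary_law_def)
  interpret B: prob_space \<mu>' using assms by (simp add: stationary_law_def)
  interpret P: pair_prob_space \<mu> \<mu>' ..
  have m: "left_shift \<in> measurable \<mu> seq_space" "left_shift \<in> measurable \<mu>' seq_space"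
    using measurable_shift by (simp_all add: measurable_cong_sets[OF s(1) refl] measurable_cong_sets[OF s(2) refl])
  have sp: "sets (\<mu> \<Otimes>\<^sub>M \<mu>') = sets (seq_space \<Otimes>\<^sub>M seq_space)"
    by (rule sets_pair_measure_cong[OF s])
  have sf: "sigma_finite_measure (distr \<mu>' seq_space left_shift)"
    unfolding d by unfold_locales
  have inv: "distr (\<mu> \<Otimes>\<^sub>M \<mu>') (seq_space \<Otimes>\<^sub>M seq_space) (map_prod left_shift left_shift) = \<mu> \<Otimes>\<^sub>M \<mu>'"
    using pair_measure_distr[OF m sf] unfolding d by (simp add: map_prod_def)
  have e1: "distr (\<mu> \<Otimes>\<^sub>M \<mu>') seq_space fst = \<mu>"
  proof -
    have "distr (\<mu> \<Otimes>\<^sub>M \<mu>') seq_space fst = distr (\<mu> \<Otimes>\<^sub>M \<mu>') \<mu> fst"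
      by (rule distr_cong) (simp_all add: s)
    then show ?thesis by (simp add: B.distr_pair_fst B.emeasure_space_1)
  qed
  have e2: "distr (\<mu> \<Otimes>\<^sub>M \<mu>') seq_space snd = \<mu>'"
  proof (rule measure_eqI)
    fix A assume "A \<in> sets (distr (\<mu> \<Otimes>\<^sub>M \<mu>') seq_space snd)"
    then have A: "A \<in> sets \<mu>'" by (simp add: s)
    have ms: "snd \<in> measurable (\<mu> \<Otimes>\<^sub>M \<mu>') seq_space"
      using measurable_snd[of \<mu> \<mu>'] by (simp add: measurable_cong_sets[OF refl s(2)])
    have "snd -` A \<inter> space (\<mu> \<Otimes>\<^sub>M \<mu>') = space \<mu> \<times> A"
      using sets.sets_into_space[OF A] by (auto simp: space_pair_measure)
    then show "emeasure (distr (\<mu> \<Otimes>\<^sub>M \<mu>') seq_space snd) A = emeasure \<mu>' A"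
      using A ms B.emeasure_pair_measure_Times[OF sets.top[of \<mu>] A] A.emeasure_space_1
      by (simp add: emeasure_distr s del: B.emeasure_pair_measure_Times)
  qed (simp add: s)
  show ?thesis
    unfolding stationary_joining_def using sp inv e1 e2 P.prob_space_axioms by auto
qed

end

theory Submission
  imports Defs "HOL-Real_Asymp.Real_Asymp"
begin

text \<open>
  Suppose that two processes are coupled so that at each time they differ with probability at
  most \<open>d\<close>. A word of length \<open>n\<close> of the first process can then be described by giving the word of
  the second process and, letter by letter, how the two differ. If agreement is given the weight
  \<open>1 - d\<close> and every other letter the weight \<open>d / k\<close>, where \<open>k\<close> is the size of the alphabet, the
  corrections cost at most \<open>- log (1 - d) - d * log (d / k)\<close> per letter on average
  (\<open>fano_bound\<close>). So the entropies of the two words of length \<open>n\<close> differ by at most \<open>n\<close> times this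
  amount, which tends to \<open>0\<close> with \<open>d\<close> and is the same for all processes over the alphabet
  (\<open>block_entropy_le_of_coupling\<close>). Dividing by \<open>n\<close> and letting \<open>n\<close> tend to infinity gives the
  same bound for the entropy rates (\<open>entropy_rate_diff_le\<close>).

  A value of the distance below \<open>d\<close> provides such a coupling: some stationary joining has
  disagreement probability less than \<open>d\<close> at time \<open>0\<close>, hence at all times by shift invariance.

  These estimates rest on the inequality of Gibbs, in the form that a code built from a
  substochastic kernel cannot beat conditional entropy (\<open>entropy_le_kernel\<close>). The kernel that
  multiplies the weights above over the letters of a word yields the comparison of the two
  processes; the kernel that ignores its condition yields subadditivity of the block entropies of
  one process, and hence, by the lemma of Fekete, the existence of the limit that defines
  the entropy rate (\<open>block_entropy_tendsto_entropy_rate\<close>).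
\<close>

section \<open>Finite entropy inequalities\<close>

lemma log_le_diff:
  fixes b p q :: real
  assumes "b > 1" "p > 0" "q > 0"
  shows "p * (log b q - log b p) \<le> (q - p) / ln b"
proof -
  have "p * ln (q / p) \<le> p * (q / p - 1)"
    using assms by (intro mult_left_mono ln_le_minus_one) auto
  also have "\<dots> = q - p" using assms by (simp add: field_simps)
  finally have "p * (ln q - ln p) / ln b \<le> (q - p) / ln b"
    using assms by (intro divide_right_mono) (auto simp: ln_div)
  then show ?thesis by (simp add: log_def diff_divide_distrib[symmetric])
qed

text \<open>
  Coding the distribution \<open>p\<close> with lengths \<open>- log q\<close> costs at least its entropy. This is
  \<open>ln x \<le> x - 1\<close> at \<open>x = q i / p i\<close>, weighted with \<open>p i\<close> and summed.
\<close>

lemma gibbs_inequality: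
  fixes b :: real and p q :: "'i \<Rightarrow> real"
  assumes b: "b > 1"
    and p: "\<And>i. i \<in> I \<Longrightarrow> p i \<ge> 0" and q: "\<And>i. i \<in> I \<Longrightarrow> q i \<ge> 0"
    and pq: "\<And>i. i \<in> I \<Longrightarrow> p i > 0 \<Longrightarrow> q i > 0"
    and le: "sum q I \<le> sum p I"
  shows "(\<Sum>i\<in>I. eta b (p i)) \<le> - (\<Sum>i\<in>I. p i * log b (q i))"
proof -
  have "(\<Sum>i\<in>I. eta b (p i) + p i * log b (q i)) \<le> (\<Sum>i\<in>I. (q i - p i) / ln b)"
  proof (rule sum_mono)
    fix i assume i: "i \<in> I"
    show "eta b (p i) + p i * log b (q i) \<le> (q i - p i) / ln b"
    proof (cases "p i = 0")
      case True
      then show ?thesis using q[OF i] b by (simp add: eta_def)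
    next
      case False
      then have "p i > 0" using p[OF i] by simp
      then show ?thesis
        using log_le_diff[OF b _ pq[OF i]] by (simp add: eta_def algebra_simps)
    qed
  qed
  also have "\<dots> = (sum q I - sum p I) / ln b"
    by (simp add: sum_divide_distrib[symmetric] sum_subtractf)
  also have "\<dots> \<le> 0" using le b by (simp add: divide_nonpos_pos)
  finally show ?thesis by (simp add: sum.distrib)
qed

text \<open>
  A marginal has at most the entropy of the joint distribution: merging the cells of \<open>I\<close> into one
  cell raises the probability that enters each logarithm.
\<close>

lemma eta_sum_le:
  fixes b :: real and f :: "'i \<Rightarrow> real"
  assumes b: "b > 1" and fin: "finite I" and f: "\<And>i. i \<in> I \<Longrightarrow> f i \<ge> 0"
  shows "eta b (sum f I) \<le> (\<Sum>i\<in>I. eta b (f i))"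
proof (cases "sum f I = 0")
  case True
  then have "\<forall>i\<in>I. f i = 0" using f fin by (simp add: sum_nonneg_eq_0_iff)
  then show ?thesis using True by (simp add: eta_def)
next
  case False
  have "eta b (sum f I) = (\<Sum>i\<in>I. - f i * log b (sum f I))"
    using False by (simp add: eta_def sum_distrib_right sum_negf)
  also have "\<dots> \<le> (\<Sum>i\<in>I. eta b (f i))"
  proof (rule sum_mono)
    fix i assume i: "i \<in> I"
    show "- f i * log b (sum f I) \<le> eta b (f i)"
    proof (cases "f i = 0")
      case nz: False
      then have pos: "f i > 0" using f[OF i] by simp
      have "f i \<le> sum f I" using i f fin by (intro member_le_sum) auto
      then have "log b (f i) \<le> log b (sum f I)" using pos b by simp
      then show ?thesis using pos by (simp add: eta_def)
    qed (simp add: eta_def)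
  qed
  finally show ?thesis .
qed

lemma entropy_marginal_eq:
  fixes b :: real and P :: "'s \<Rightarrow> 't \<Rightarrow> real"
  shows "(\<Sum>t\<in>T. eta b (\<Sum>s\<in>S. P s t)) = - (\<Sum>s\<in>S. \<Sum>t\<in>T. P s t * log b (\<Sum>s\<in>S. P s t))"
proof -
  have "(\<Sum>t\<in>T. eta b (\<Sum>s\<in>S. P s t)) = (\<Sum>t\<in>T. - (\<Sum>s\<in>S. P s t) * log b (\<Sum>s\<in>S. P s t))"
    by (intro sum.cong refl) (auto simp: eta_def)
  also have "\<dots> = - (\<Sum>t\<in>T. \<Sum>s\<in>S. P s t * log b (\<Sum>s\<in>S. P s t))"
    by (simp add: sum_distrib_right sum_negf)
  also have "\<dots> = - (\<Sum>s\<in>S. \<Sum>t\<in>T. P s t * log b (\<Sum>s\<in>S. P s t))"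
    by (subst sum.swap) simp
  finally show ?thesis .
qed

text \<open>
  With \<open>P\<close> the joint distribution of two variables \<open>s\<close> and \<open>t\<close>, the joint entropy is at most the
  entropy of \<open>t\<close> plus the average cost of coding \<open>s\<close> given \<open>t\<close> with the weights \<open>K s t\<close>. It is the
  Gibbs inequality for \<open>P\<close> against \<open>R t * K s t\<close>, where \<open>R\<close> is the marginal of \<open>t\<close>.
\<close>

lemma entropy_le_kernel:
  fixes b :: real and P K :: "'s \<Rightarrow> 't \<Rightarrow> real"
  assumes b: "b > 1" and fin: "finite S" "finite T"
    and P: "\<And>s t. s \<in> S \<Longrightarrow> t \<in> T \<Longrightarrow> P s t \<ge> 0"
    and K: "\<And>s t. s \<in> S \<Longrightarrow> t \<in> T \<Longrightarrow> K s t \<ge> 0"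
    and PK: "\<And>s t. s \<in> S \<Longrightarrow> t \<in> T \<Longrightarrow> P s t > 0 \<Longrightarrow> K s t > 0"
    and sub: "\<And>t. t \<in> T \<Longrightarrow> (\<Sum>s\<in>S. K s t) \<le> 1"
  shows "(\<Sum>s\<in>S. \<Sum>t\<in>T. eta b (P s t))
    \<le> (\<Sum>t\<in>T. eta b (\<Sum>s\<in>S. P s t)) - (\<Sum>s\<in>S. \<Sum>t\<in>T. P s t * log b (K s t))"
proof -
  define R where "R t = (\<Sum>s\<in>S. P s t)" for t
  have R: "R t \<ge> 0" if "t \<in> T" for t using P that by (auto simp: R_def intro: sum_nonneg)
  have Rpos: "R t > 0" if "s \<in> S" "t \<in> T" "P s t > 0" for s t
    using that P fin by (auto simp: R_def intro: sum_pos2)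
  have "(\<Sum>s\<in>S. \<Sum>t\<in>T. eta b (P s t)) = (\<Sum>(s,t)\<in>S \<times> T. eta b (P s t))"
    by (simp add: sum.cartesian_product)
  also have "\<dots> = (\<Sum>z\<in>S \<times> T. eta b (case z of (s,t) \<Rightarrow> P s t))"
    by (intro sum.cong) auto
  also have "\<dots> \<le> - (\<Sum>z\<in>S \<times> T. (case z of (s,t) \<Rightarrow> P s t) * log b (case z of (s,t) \<Rightarrow> R t * K s t))"
  proof (rule gibbs_inequality[OF b])
    have "(\<Sum>(s,t)\<in>S \<times> T. R t * K s t) = (\<Sum>t\<in>T. R t * (\<Sum>s\<in>S. K s t))"
      by (simp add: sum.cartesian_product[symmetric] sum_distrib_left) (rule sum.swap)
    also have "\<dots> \<le> (\<Sum>t\<in>T. R t * 1)"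
      using R sub by (intro sum_mono mult_left_mono) auto
    also have "\<dots> = (\<Sum>(s,t)\<in>S \<times> T. P s t)"
      by (simp add: sum.cartesian_product[symmetric] R_def) (rule sum.swap)
    finally show "(\<Sum>(s,t)\<in>S \<times> T. R t * K s t) \<le> (\<Sum>(s,t)\<in>S \<times> T. P s t)" .
  qed (use P K R PK Rpos in auto)
  also have "\<dots> = - (\<Sum>s\<in>S. \<Sum>t\<in>T. P s t * log b (R t * K s t))"
    by (simp add: sum.cartesian_product case_prod_beta)
  also have "(\<Sum>s\<in>S. \<Sum>t\<in>T. P s t * log b (R t * K s t))
      = (\<Sum>s\<in>S. \<Sum>t\<in>T. P s t * log b (R t) + P s t * log b (K s t))"
  proof (intro sum.cong refl)
    fix s t assume st: "s \<in> S" "t \<in> T"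
    show "P s t * log b (R t * K s t) = P s t * log b (R t) + P s t * log b (K s t)"
    proof (cases "P s t = 0")
      case False
      then have "P s t > 0" using P[OF st] by simp
      then show ?thesis using Rpos[OF st] PK[OF st]
        by (simp add: log_mult algebra_simps)
    qed simp
  qed
  finally show ?thesis
    by (simp add: entropy_marginal_eq R_def sum.distrib)
qed

section \<open>Laws of finitely-valued observables\<close>

lemma (in finite_measure) measure_finite_valued:
  assumes f: "f \<in> measurable M (count_space UNIV)" and T: "finite T"
  shows "measure M {x \<in> space M. f x \<in> T} = (\<Sum>t\<in>T. measure M {x \<in> space M. f x = t})"
proof -
  have ms: "{x \<in> space M. f x = t} \<in> sets M" for t
    using measurable_sets[OF f, of "{t}"] by (simp add: vimage_def Int_def conj_commute)
  have "{x \<in> space M. f x \<in> T} = (\<Union>t\<in>T. {x \<in> space M. f x = t})" by auto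
  then show ?thesis
    using finite_measure_finite_Union[OF T, of "\<lambda>t. {x \<in> space M. f x = t}"] ms
    by (auto simp: disjoint_family_on_def)
qed

lemma (in finite_measure) measure_finite_valued_partition:
  assumes f: "f \<in> measurable M (count_space UNIV)" and g: "g \<in> measurable M (count_space UNIV)"
    and T: "finite T" and range: "\<And>x. x \<in> space M \<Longrightarrow> g x \<in> T"
  shows "measure M {x \<in> space M. f x = s} = (\<Sum>t\<in>T. measure M {x \<in> space M. f x = s \<and> g x = t})"
proof -
  have ms: "{x \<in> space M. f x = s} \<in> sets M" "{x \<in> space M. g x = t} \<in> sets M" for s t
    using measurable_sets[OF f, of "{s}"] measurable_sets[OF g, of "{t}"]
    by (simp_all add: vimage_def Int_def conj_commute)
  have "{x \<in> space M. f x = s \<and> g x = t} \<in> sets M" for t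
    by (rule sets.sets_Collect_conj[OF ms(2,1)])
  moreover have "{x \<in> space M. f x = s} = (\<Union>t\<in>T. {x \<in> space M. f x = s \<and> g x = t})"
    using range by auto
  ultimately show ?thesis
    using finite_measure_finite_Union[OF T, of "\<lambda>t. {x \<in> space M. f x = s \<and> g x = t}"]
    by (auto simp: disjoint_family_on_def)
qed

section \<open>Words and block entropies\<close>

definition words :: "nat \<Rightarrow> 'a list set" where
  "words n = {w. length w = n}"

text \<open>
  Words are images of a measurable function on sequences, so that cylinders become
  the level sets of one observable with finitely many values.
\<close>

definition word :: "nat \<Rightarrow> (nat \<Rightarrow> 'a) \<Rightarrow> 'a list" where
  "word n x = map x [0..<n]"

definition block_entropy :: "real \<Rightarrow> (nat \<Rightarrow> 'a::finite) measure \<Rightarrow> nat \<Rightarrow> real" where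
  "block_entropy b \<nu> n = (\<Sum>w\<in>words n. eta b (measure \<nu> {x. word n x = w}))"

lemma finite_words: "finite (words n :: 'a::finite list set)"
  using finite_lists_length_eq[of "UNIV :: 'a set" n] by (simp add: words_def)

lemma word_in_words: "word n x \<in> words n"
  by (simp add: word_def words_def)

lemma length_word: "length (word n x) = n"
  by (simp add: word_def)

lemma nth_word: "i < n \<Longrightarrow> word n x ! i = x i"
  by (simp add: word_def)

lemma word_eq_iff:
  assumes "w \<in> words n" shows "word n x = w \<longleftrightarrow> (\<forall>i<n. x i = w ! i)"
  using assms by (auto simp: words_def word_def list_eq_iff_nth_eq)

lemma entropy_rate_eq_lim: "entropy_rate b \<nu> = lim (\<lambda>n. block_entropy b \<nu> n / real n)"
proof -
  have "(\<Sum>w\<in>{w. length w = n}. eta b (measure \<nu> {x. \<forall>i<n. x i = w ! i})) = block_entropy b \<nu> n" for n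
    unfolding block_entropy_def words_def[symmetric]
    by (intro sum.cong refl) (simp add: word_eq_iff)
  then show ?thesis by (simp add: entropy_rate_def)
qed

lemma measurable_word:
  assumes "\<And>i. X i \<in> measurable M (count_space (UNIV :: 'a::finite set))"
  shows "(\<lambda>\<omega>. word n (\<lambda>i. X i \<omega>)) \<in> measurable M (count_space UNIV)"
proof (subst measurable_count_space_eq_countable)
  show "countable (UNIV :: 'a list set)" by simp
  have "(\<lambda>\<omega>. word n (\<lambda>i. X i \<omega>)) -` {w} \<inter> space M \<in> sets M" for w
  proof (cases "w \<in> words n")
    case True
    have "{\<omega> \<in> space M. X i \<omega> = a} \<in> sets M" for i a
      using measurable_sets[OF assms, of "{a}" i] by (simp add: vimage_def Int_def conj_commute)
    then have "{\<omega> \<in> space M. \<forall>i\<in>{..<n}. X i \<omega> = w ! i} \<in> sets M"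
      by (intro sets.sets_Collect_finite_All) auto
    also have "{\<omega> \<in> space M. \<forall>i\<in>{..<n}. X i \<omega> = w ! i} = (\<lambda>\<omega>. word n (\<lambda>i. X i \<omega>)) -` {w} \<inter> space M"
      by (auto simp: word_eq_iff[OF True] nth_word)
    finally show ?thesis .
  next
    case False
    then have "(\<lambda>\<omega>. word n (\<lambda>i. X i \<omega>)) -` {w} = {}" using word_in_words by fastforce
    then show ?thesis by simp
  qed
  then show "(\<lambda>\<omega>. word n (\<lambda>i. X i \<omega>)) \<in> space M \<rightarrow> UNIV \<and>
     (\<forall>w\<in>UNIV. (\<lambda>\<omega>. word n (\<lambda>i. X i \<omega>)) -` {w} \<inter> space M \<in> sets M)" by simp
qed

text \<open>
  Block entropies can be computed on any sample space, so the two processes of a joining can be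
  compared inside the joining.
\<close>

lemma block_entropy_process_law:
  assumes X: "\<And>i. X i \<in> measurable M (count_space (UNIV :: 'a::finite set))"
  shows "block_entropy b (process_law M X) n
    = (\<Sum>w\<in>words n. eta b (measure M {\<omega> \<in> space M. word n (\<lambda>i. X i \<omega>) = w}))"
proof -
  have "{x. word n x = w} \<in> sets (seq_space :: (nat \<Rightarrow> 'a) measure)" for w
    using measurable_sets[OF measurable_word[OF measurable_coord], of "{w}" n]
    by (simp add: vimage_def)
  then have "measure (process_law M X) {x. word n x = w} = measure M {\<omega> \<in> space M. word n (\<lambda>i. X i \<omega>) = w}" for w
    unfolding process_law_def
    by (subst measure_distr) (auto intro!: measurable_seq_space X arg_cong[where f = "measure M"])
  then show ?thesis by (simp add: block_entropy_def)
qed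

section \<open>Existence of the entropy rate\<close>

text \<open>
  Fekete's lemma. The limit is the infimum \<open>L\<close> of the quotients: if \<open>m\<close> almost attains it, cutting
  \<open>n\<close> into blocks of length \<open>m\<close> bounds \<open>a n / n\<close> by \<open>a m / m\<close> plus the contribution of the remainder
  \<open>n mod m\<close>, which is bounded and disappears after division by \<open>n\<close>.
\<close>

lemma subadditive_convergent:
  fixes a :: "nat \<Rightarrow> real"
  assumes sub: "\<And>m n. a (m + n) \<le> a m + a n" and nonneg: "\<And>n. a n \<ge> 0"
  shows "convergent (\<lambda>n. a n / real n)"
proof -
  define L where "L = (INF n\<in>{0<..}. a n / real n)"
  have bdd: "bdd_below ((\<lambda>n. a n / real n) ` {0<..})"
    using nonneg by (intro bdd_belowI[of _ 0]) auto
  have mult: "a (q * m + r) \<le> real q * a m + a r" for q m r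
  proof (induction q)
    case (Suc q)
    have "a (Suc q * m + r) \<le> a m + a (q * m + r)"
      using sub[of m "q * m + r"] by (simp add: add.assoc)
    then show ?case using Suc by (simp add: algebra_simps)
  qed simp
  have "(\<lambda>n. a n / real n) \<longlonglongrightarrow> L"
  proof (rule LIMSEQ_I)
    fix e :: real assume e: "e > 0"
    have "\<exists>m\<in>{0<..}. a m / real m < L + e / 2"
      using cINF_less_iff[OF _ bdd, of "L + e / 2"] e by (auto simp: L_def[symmetric])
    then obtain m where m: "m > 0" and am: "a m / real m < L + e / 2" by auto
    define C where "C = (\<Sum>r<m. a r)"
    have C: "a r \<le> C" if "r < m" for r
      unfolding C_def using that nonneg by (intro member_le_sum) auto
    obtain N where N: "real N > 2 * C / e" using reals_Archimedean2 by blast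
    have "norm (a n / real n - L) < e" if n: "n \<ge> Suc N" for n
    proof -
      have npos: "real n > 0" using n by simp
      have "a n \<le> real (n div m) * a m + a (n mod m)"
        using mult[of "n div m" m "n mod m"] by simp
      also have "\<dots> \<le> real n / real m * a m + C"
        using m nonneg C by (intro add_mono mult_right_mono) (auto simp: of_nat_div_le_of_nat)
      finally have "a n / real n \<le> (real n / real m * a m + C) / real n"
        using npos by (intro divide_right_mono) auto
      also have "\<dots> = a m / real m + C / real n" using npos m by (simp add: field_simps)
      also have "C / real n < e / 2"
      proof -
        have "2 * C / e < real n" using N n by linarith
        then show ?thesis using npos e by (simp add: field_simps)
      qed
      finally have "a n / real n < L + e" using am by linarith
      moreover have "L \<le> a n / real n"
        unfolding L_def using n by (intro cINF_lower[OF bdd]) auto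
      ultimately show ?thesis using e by simp
    qed
    then show "\<exists>no. \<forall>n\<ge>no. norm (a n / real n - L) < e" by blast
  qed
  then show ?thesis by (rule convergentI)
qed

lemma word_add: "word (m + n) x = word m x @ word n (\<lambda>i. x (i + m))"
  unfolding word_def
  by (auto simp: list_eq_iff_nth_eq nth_append)

lemma words_add: "words (m + n) = (\<lambda>(u, v). u @ v) ` (words m \<times> words n)"
proof (intro equalityI subsetI)
  fix w :: "'a list" assume "w \<in> words (m + n)"
  then have "w = (\<lambda>(u, v). u @ v) (take m w, drop m w)"
    and "(take m w, drop m w) \<in> words m \<times> words n"
    by (auto simp: words_def)
  then show "w \<in> (\<lambda>(u, v). u @ v) ` (words m \<times> words n)" by (rule image_eqI)
qed (auto simp: words_def)

lemma inj_on_append_words: "inj_on (\<lambda>(u, v). u @ v) (words m \<times> words n)"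
  by (auto simp: inj_on_def words_def)

lemma stationary_law_shift:
  assumes "stationary_law \<mu>"
  shows "process_law \<mu> (\<lambda>i x. x (i + m)) = \<mu>"
proof (induction m)
  case 0
  then show ?case using stationary_law_coordinate_process(2)[OF assms] by simp
next
  case (Suc m)
  have s: "sets \<mu> = sets seq_space" and d: "distr \<mu> seq_space left_shift = \<mu>"
    using assms by (auto simp: stationary_law_def)
  have sh: "left_shift \<in> measurable \<mu> seq_space"
    using measurable_shift by (simp add: measurable_cong_sets[OF s refl])
  have me: "(\<lambda>x i. x (i + m)) \<in> measurable seq_space seq_space"
    by (intro measurable_seq_space measurable_coord)
  have "process_law \<mu> (\<lambda>i x. x (i + Suc m)) = distr \<mu> seq_space ((\<lambda>x i. x (i + m)) \<circ> left_shift)"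
    by (simp add: process_law_def comp_def left_shift_def)
  also have "\<dots> = distr (distr \<mu> seq_space left_shift) seq_space (\<lambda>x i. x (i + m))"
    by (rule distr_distr[OF me sh, symmetric])
  also have "\<dots> = \<mu>" using Suc by (simp add: d process_law_def)
  finally show ?case .
qed

text \<open>
  A word of length \<open>m + n\<close> consists of a prefix \<open>u\<close> and a suffix \<open>v\<close>, and by stationarity the suffix
  has the law of a word of length \<open>n\<close>. Coding \<open>u\<close> with its own law, whatever \<open>v\<close> is, costs on average
  the entropy of \<open>u\<close>.
\<close>

lemma block_entropy_subadditive:
  assumes b: "b > 1" and st: "stationary_law \<mu>"
  shows "block_entropy b \<mu> (m + n) \<le> block_entropy b \<mu> m + block_entropy b \<mu> n"
proof -
  interpret prob_space \<mu> using st by (simp add: stationary_law_def)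
  have s: "sets \<mu> = sets seq_space" using st by (simp add: stationary_law_def)
  have sp: "space \<mu> = UNIV" using sets_eq_imp_space_eq[OF s] by simp
  have coord: "(\<lambda>x. x i) \<in> measurable \<mu> (count_space UNIV)" for i
    using measurable_coord by (simp add: measurable_cong_sets[OF s refl])
  define P where "P u v = measure \<mu> {x \<in> space \<mu>. word m x = u \<and> word n (\<lambda>i. x (i + m)) = v}" for u v
  define p where "p k w = measure \<mu> {x. word k x = w}" for k w
  have mw: "(\<lambda>x. word m x) \<in> measurable \<mu> (count_space UNIV)"
    "(\<lambda>x. word n (\<lambda>i. x (i + m))) \<in> measurable \<mu> (count_space UNIV)"
    by (intro measurable_word coord)+
  have shift: "measure \<mu> {x \<in> space \<mu>. word n (\<lambda>i. x (i + m)) = v} = p n v" for v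
  proof -
    have "measure (process_law \<mu> (\<lambda>i x. x (i + m))) {x. word n x = v} = measure \<mu> {x \<in> space \<mu>. word n (\<lambda>i. x (i + m)) = v}"
      unfolding process_law_def
      using measurable_sets[OF measurable_word[OF measurable_coord], of "{v}" n]
      by (subst measure_distr)
         (auto simp: vimage_def intro!: measurable_seq_space coord arg_cong[where f = "measure \<mu>"])
    then show ?thesis by (simp add: stationary_law_shift[OF st] p_def)
  qed
  have Pu: "p m u = (\<Sum>v\<in>words n. P u v)" for u
    using measure_finite_valued_partition[OF mw finite_words[of n], of u]
    by (simp add: P_def p_def sp word_in_words)
  have Pv: "p n v = (\<Sum>u\<in>words m. P u v)" for v
    using measure_finite_valued_partition[OF mw(2,1) finite_words[of m], of v] shift
    by (simp add: P_def sp word_in_words conj_commute)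
  have tot: "(\<Sum>u\<in>words m. p m u) = 1"
    using measure_finite_valued[OF mw(1) finite_words[of m]] prob_space
    by (simp add: p_def sp word_in_words)
  have "block_entropy b \<mu> (m + n) = (\<Sum>(u, v)\<in>words m \<times> words n. eta b (p (m + n) (u @ v)))"
    unfolding block_entropy_def p_def[symmetric] words_add
    by (subst sum.reindex[OF inj_on_append_words]) (simp add: case_prod_beta)
  also have "\<dots> = (\<Sum>(u, v)\<in>words m \<times> words n. eta b (P u v))"
    by (intro sum.cong refl) (auto simp: p_def P_def sp word_add words_def length_word)
  also have "\<dots> = (\<Sum>u\<in>words m. \<Sum>v\<in>words n. eta b (P u v))"
    by (simp add: sum.cartesian_product)
  also have "\<dots> \<le> (\<Sum>v\<in>words n. eta b (\<Sum>u\<in>words m. P u v))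
      - (\<Sum>u\<in>words m. \<Sum>v\<in>words n. P u v * log b (p m u))"
  proof (rule entropy_le_kernel[OF b finite_words finite_words])
    fix u v assume "u \<in> words m" "v \<in> words n" "P u v > 0"
    then show "p m u > 0" unfolding Pu by (auto intro!: sum_pos2 finite_words simp: P_def)
  qed (use tot in \<open>auto simp: P_def p_def\<close>)
  also have "(\<Sum>v\<in>words n. eta b (\<Sum>u\<in>words m. P u v)) = block_entropy b \<mu> n"
    by (simp add: block_entropy_def Pv[symmetric] p_def)
  finally have "block_entropy b \<mu> (m + n)
      \<le> block_entropy b \<mu> n - (\<Sum>u\<in>words m. \<Sum>v\<in>words n. P u v * log b (p m u))" .
  moreover have "- (\<Sum>u\<in>words m. \<Sum>v\<in>words n. P u v * log b (p m u)) = block_entropy b \<mu> m"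
    unfolding block_entropy_def p_def[symmetric] sum_distrib_right[symmetric] Pu[symmetric]
    by (simp add: sum_negf[symmetric] eta_def) (intro sum.cong, auto)
  ultimately show ?thesis by simp
qed

lemma eta_nonneg: "b > 1 \<Longrightarrow> 0 \<le> t \<Longrightarrow> t \<le> 1 \<Longrightarrow> eta b t \<ge> 0"
  by (auto simp: eta_def mult_nonneg_nonpos)

text \<open>
  The entropy rate is defined by \<open>lim\<close>, which has an unspecified value for divergent sequences; here
  it is seen to be an actual limit.
\<close>

lemma block_entropy_tendsto_entropy_rate:
  assumes b: "b > 1" and st: "stationary_law \<mu>"
  shows "(\<lambda>n. block_entropy b \<mu> n / real n) \<longlonglongrightarrow> entropy_rate b \<mu>"
proof -
  interpret prob_space \<mu> using st by (simp add: stationary_law_def)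
  have "block_entropy b \<mu> n \<ge> 0" for n
    unfolding block_entropy_def by (intro sum_nonneg eta_nonneg b) auto
  then have "convergent (\<lambda>n. block_entropy b \<mu> n / real n)"
    by (intro subadditive_convergent block_entropy_subadditive[OF b st])
  then show ?thesis by (simp add: entropy_rate_eq_lim convergent_LIMSEQ_iff)
qed

section \<open>Continuity under a coupling\<close>

text \<open>
  Weights of a letter \<open>a\<close> given a guess \<open>y\<close> that is wrong with probability at most \<open>d\<close>. Dividing \<open>d\<close> by
  the size of the alphabet, rather than by the number of wrong letters, makes the sum
  smaller than \<open>1\<close>, but is meaningful also for an alphabet with one letter.
\<close>

definition flip_kernel :: "real \<Rightarrow> 'a::finite \<Rightarrow> 'a \<Rightarrow> real" where
  "flip_kernel d y a = (if a = y then 1 - d else d / real CARD('a))"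

lemma sum_flip_kernel_le:
  assumes "0 \<le> d"
  shows "(\<Sum>a\<in>UNIV. flip_kernel d y (a :: 'a::finite)) \<le> 1"
proof -
  have "(\<Sum>a\<in>UNIV. flip_kernel d y (a :: 'a)) \<le> (\<Sum>a\<in>(UNIV :: 'a set). (if a = y then 1 - d else 0) + d / real CARD('a))"
    using assms by (intro sum_mono) (auto simp: flip_kernel_def)
  also have "\<dots> = 1" by (simp add: sum.distrib)
  finally show ?thesis .
qed

text \<open>
  Weights that multiply over the letters have a sum over all words that factorises; so the product of
  substochastic letter kernels is a substochastic kernel on words.
\<close>

lemma sum_words_prod:
  fixes k :: "nat \<Rightarrow> 'a::finite \<Rightarrow> real"
  shows "(\<Sum>w\<in>words n. \<Prod>i<n. k i (w ! i)) = (\<Prod>i<n. \<Sum>a\<in>UNIV. k i a)"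
proof (induction n)
  case 0
  have "words 0 = {[] :: 'a list}" by (auto simp: words_def)
  then show ?case by simp
next
  case (Suc n)
  \<comment> \<open>The last letter is split off as a word of length \<open>1\<close>.\<close>
  have w1: "words 1 = (\<lambda>a :: 'a. [a]) ` UNIV" by (auto simp: words_def length_Suc_conv)
  have "(\<Sum>w\<in>words (n + 1). \<Prod>i<Suc n. k i (w ! i))
      = (\<Sum>(u, v)\<in>words n \<times> words 1. \<Prod>i<Suc n. k i ((u @ v) ! i))"
    unfolding words_add by (subst sum.reindex[OF inj_on_append_words]) (simp add: case_prod_beta)
  also have "\<dots> = (\<Sum>u\<in>words n. \<Sum>v\<in>words 1. \<Prod>i<Suc n. k i ((u @ v) ! i))"
    by (simp add: sum.cartesian_product)
  also have "\<dots> = (\<Sum>u\<in>words n. \<Sum>a\<in>UNIV. (\<Prod>i<n. k i (u ! i)) * k n a)"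
    unfolding w1
    by (intro sum.cong refl, subst sum.reindex)
       (auto simp: inj_on_def words_def nth_append intro!: sum.cong prod.cong)
  also have "\<dots> = (\<Sum>u\<in>words n. \<Prod>i<n. k i (u ! i)) * (\<Sum>a\<in>UNIV. k n a)"
    by (simp add: sum_product)
  finally show ?case using Suc by simp
qed

text \<open>
  A bound for the average cost per letter of coding with \<open>flip_kernel\<close>, for an alphabet of size \<open>k\<close>: the first
  summand is charged for every letter, and \<open>- log b (d / k)\<close> in addition for each disagreement.
\<close>

definition fano_bound :: "real \<Rightarrow> real \<Rightarrow> real \<Rightarrow> real" where
  "fano_bound b k d = - log b (1 - d) - d * log b (d / k)"

text \<open>
  The word \<open>u\<close> of \<open>X\<close> is coded given the word \<open>v\<close> of \<open>Y\<close>, with the product of the letter kernels. The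
  logarithm of a product is a sum over the positions, and the expected cost at a position is
  bounded through the probability that \<open>X\<close> and \<open>Y\<close> disagree there, so expectations add up
  however the different times depend on each other.
\<close>

lemma block_entropy_le_of_coupling:
  fixes X Y :: "nat \<Rightarrow> 'w \<Rightarrow> 'a::finite"
  assumes b: "b > 1" and d: "0 < d" "d < 1" and M: "prob_space M"
    and X: "\<And>i. X i \<in> measurable M (count_space UNIV)"
    and Y: "\<And>i. Y i \<in> measurable M (count_space UNIV)"
    and close: "\<And>i. measure M {\<omega> \<in> space M. X i \<omega> \<noteq> Y i \<omega>} \<le> d"
  shows "block_entropy b (process_law M X) n
    \<le> block_entropy b (process_law M Y) n + real n * fano_bound b (real CARD('a)) d"
proof -
  interpret prob_space M by fact
  define f where "f \<omega> = word n (\<lambda>i. X i \<omega>)" for \<omega>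
  define g where "g \<omega> = word n (\<lambda>i. Y i \<omega>)" for \<omega>
  have fg: "f \<in> measurable M (count_space UNIV)" "g \<in> measurable M (count_space UNIV)"
    unfolding f_def[abs_def] g_def[abs_def] by (intro measurable_word X Y)+
  have fgW: "f \<omega> \<in> words n" "g \<omega> \<in> words n" for \<omega> by (simp_all add: f_def g_def word_in_words)
  have pm: "(\<lambda>\<omega>. (f \<omega>, g \<omega>)) \<in> measurable M (count_space UNIV)"
    using measurable_Pair[OF fg]
    by (simp add: pair_measure_countable)
  define P where "P u v = measure M {\<omega> \<in> space M. f \<omega> = u \<and> g \<omega> = v}" for u v
  define K :: "'a list \<Rightarrow> 'a list \<Rightarrow> real" where "K u v = (\<Prod>i<n. flip_kernel d (v ! i) (u ! i))" for u v
  have Pf: "measure M {\<omega> \<in> space M. f \<omega> = u} = (\<Sum>v\<in>words n. P u v)" for u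
    unfolding P_def by (rule measure_finite_valued_partition[OF fg finite_words fgW(2)])
  have Pg: "measure M {\<omega> \<in> space M. g \<omega> = v} = (\<Sum>u\<in>words n. P u v)" for v
    using measure_finite_valued_partition[OF fg(2,1) finite_words fgW(1), of v]
    by (simp add: P_def conj_commute)
  \<comment> \<open>Sums of \<open>P\<close> over a relation between words are probabilities; it is applied to the
    trivial relation (total mass) and to disagreement at a position.\<close>
  have joint: "(\<Sum>u\<in>words n. \<Sum>v\<in>words n. P u v * of_bool (Q u v))
      = measure M {\<omega> \<in> space M. Q (f \<omega>) (g \<omega>)}" for Q
  proof -
    let ?T = "{z \<in> words n \<times> words n. Q (fst z) (snd z)}"
    have "(\<Sum>u\<in>words n. \<Sum>v\<in>words n. P u v * of_bool (Q u v))
        = (\<Sum>z\<in>words n \<times> words n. if Q (fst z) (snd z) then P (fst z) (snd z) else 0)"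
      by (auto simp: sum.cartesian_product intro!: sum.cong)
    also have "\<dots> = (\<Sum>z\<in>?T. P (fst z) (snd z))"
      by (rule sum.inter_filter[symmetric]) (simp add: finite_words)
    also have "\<dots> = (\<Sum>z\<in>?T. measure M {\<omega> \<in> space M. (f \<omega>, g \<omega>) = z})"
      by (auto simp: P_def intro!: sum.cong)
    also have "\<dots> = measure M {\<omega> \<in> space M. (f \<omega>, g \<omega>) \<in> ?T}"
      by (rule measure_finite_valued[OF pm, symmetric]) (simp add: finite_words)
    also have "\<dots> = measure M {\<omega> \<in> space M. Q (f \<omega>) (g \<omega>)}" using fgW by simp
    finally show ?thesis .
  qed
  \<comment> \<open>The cost of a letter is at most \<open>c1\<close>, plus \<open>c2\<close> if the letters disagree.\<close>
  define c1 where "c1 = - log b (1 - d)"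
  define c2 where "c2 = - log b (d / real CARD('a))"
  have card: "real CARD('a) \<ge> 1" by (simp add: Suc_leI)
  have kpos: "flip_kernel d y (a::'a) > 0" for y a using d by (simp add: flip_kernel_def)
  have "d / real CARD('a) \<le> 1" using order_trans[OF less_imp_le[OF d(2)] card] by simp
  then have c: "c1 \<ge> 0" "c2 \<ge> 0" using b d by (auto simp: c1_def c2_def)
  have logk: "- log b (flip_kernel d y a) \<le> c1 + c2 * of_bool (a \<noteq> y)" for y a :: 'a
    using c by (auto simp: flip_kernel_def c1_def c2_def)
  have logK: "- log b (K u v) \<le> (\<Sum>i<n. c1 + c2 * of_bool (u ! i \<noteq> v ! i))" for u v
  proof -
    have "- log b (K u v) = (\<Sum>i<n. - log b (flip_kernel d (v ! i) (u ! i)))"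
      unfolding K_def log_def using kpos
      by (subst ln_prod) (auto simp: sum_divide_distrib sum_negf less_imp_neq[OF kpos, symmetric])
    also have "\<dots> \<le> (\<Sum>i<n. c1 + c2 * of_bool (u ! i \<noteq> v ! i))"
      by (intro sum_mono logk)
    finally show ?thesis .
  qed
  have "block_entropy b (process_law M X) n = (\<Sum>u\<in>words n. eta b (\<Sum>v\<in>words n. P u v))"
    by (simp add: block_entropy_process_law[OF X] f_def[symmetric] Pf)
  also have "\<dots> \<le> (\<Sum>u\<in>words n. \<Sum>v\<in>words n. eta b (P u v))"
    by (intro sum_mono eta_sum_le b finite_words) (simp add: P_def)
  also have "\<dots> \<le> (\<Sum>v\<in>words n. eta b (\<Sum>u\<in>words n. P u v))
      - (\<Sum>u\<in>words n. \<Sum>v\<in>words n. P u v * log b (K u v))"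
  proof (rule entropy_le_kernel[OF b finite_words finite_words])
    fix v :: "'a list"
    have "(\<Sum>u\<in>words n. K u v) = (\<Prod>i<n. \<Sum>a\<in>UNIV. flip_kernel d (v ! i) a)"
      unfolding K_def by (rule sum_words_prod)
    also have "\<dots> \<le> 1"
      using d(1) by (intro prod_le_1 conjI sum_nonneg less_imp_le[OF kpos] sum_flip_kernel_le) simp
    finally show "(\<Sum>u\<in>words n. K u v) \<le> 1" .
  qed (auto simp: P_def K_def intro!: prod_nonneg prod_pos kpos less_imp_le)
  also have "(\<Sum>v\<in>words n. eta b (\<Sum>u\<in>words n. P u v)) = block_entropy b (process_law M Y) n"
    by (simp add: block_entropy_process_law[OF Y] g_def[symmetric] Pg)
  finally have "block_entropy b (process_law M X) n
      \<le> block_entropy b (process_law M Y) n - (\<Sum>u\<in>words n. \<Sum>v\<in>words n. P u v * log b (K u v))" .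
  moreover have "- (\<Sum>u\<in>words n. \<Sum>v\<in>words n. P u v * log b (K u v)) \<le> real n * (c1 + c2 * d)"
  proof -
    have "- (\<Sum>u\<in>words n. \<Sum>v\<in>words n. P u v * log b (K u v))
        = (\<Sum>u\<in>words n. \<Sum>v\<in>words n. P u v * (- log b (K u v)))"
      by (simp add: sum_negf)
    also have "\<dots> \<le> (\<Sum>u\<in>words n. \<Sum>v\<in>words n. P u v * (\<Sum>i<n. c1 + c2 * of_bool (u ! i \<noteq> v ! i)))"
      by (intro sum_mono mult_left_mono logK) (simp add: P_def)
    also have "\<dots> = (\<Sum>u\<in>words n. \<Sum>v\<in>words n. \<Sum>i<n. c1 * (P u v * of_bool True) + c2 * (P u v * of_bool (u ! i \<noteq> v ! i)))"
      by (simp add: sum_distrib_left algebra_simps)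
    also have "\<dots> = (\<Sum>i<n. \<Sum>u\<in>words n. \<Sum>v\<in>words n. c1 * (P u v * of_bool True) + c2 * (P u v * of_bool (u ! i \<noteq> v ! i)))"
      by (subst sum.swap[of _ "{..<n}"], subst (2) sum.swap, rule refl)
    also have "\<dots> = (\<Sum>i<n. c1 * measure M {\<omega> \<in> space M. True} + c2 * measure M {\<omega> \<in> space M. f \<omega> ! i \<noteq> g \<omega> ! i})"
      by (simp only: sum.distrib sum_distrib_left[symmetric] joint)
    also have "\<dots> \<le> (\<Sum>i<n. c1 + c2 * d)"
      using close c
      by (intro sum_mono add_mono mult_left_mono) (auto simp: prob_space f_def g_def nth_word)
    finally show ?thesis by simp
  qed
  ultimately show ?thesis by (simp add: fano_bound_def c1_def c2_def algebra_simps)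
qed

text \<open>
  Invariance under the simultaneous shift carries the disagreement probability from time \<open>0\<close> to
  every other time.
\<close>

lemma stationary_joining_disagreement:
  fixes \<mu> \<mu>' :: "(nat \<Rightarrow> 'a::finite) measure"
  assumes J: "stationary_joining \<mu> \<mu>' \<xi>"
  shows "measure \<xi> {z \<in> space \<xi>. fst z i \<noteq> snd z i} = measure \<xi> {(x, x'). x 0 \<noteq> x' 0}"
proof -
  let ?N = "seq_space \<Otimes>\<^sub>M seq_space :: ((nat \<Rightarrow> 'a) \<times> (nat \<Rightarrow> 'a)) measure"
  let ?D = "\<lambda>i. {z :: (nat \<Rightarrow> 'a) \<times> (nat \<Rightarrow> 'a). fst z i \<noteq> snd z i}"
  have s: "sets \<xi> = sets ?N"
    and inv: "distr \<xi> ?N (map_prod left_shift left_shift) = \<xi>"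
    using J by (auto simp: stationary_joining_def)
  have sp: "space \<xi> = UNIV" using sets_eq_imp_space_eq[OF s] by (simp add: space_pair_measure)
  have mc: "(\<lambda>z. fst z i) \<in> measurable ?N (count_space UNIV)"
    "(\<lambda>z. snd z i) \<in> measurable ?N (count_space UNIV)" for i
    by (rule measurable_compose[OF measurable_fst measurable_coord]
        measurable_compose[OF measurable_snd measurable_coord])+
  have D: "?D i \<in> sets ?N" for i
  proof -
    have "(\<lambda>z. (fst z i, snd z i)) \<in> measurable ?N (count_space UNIV)"
      using measurable_Pair[OF mc] by (simp add: pair_measure_countable)
    from measurable_sets[OF this, of "{(a, a'). a \<noteq> a'}"] show ?thesis
      by (simp add: vimage_def space_pair_measure)
  qed
  have sh: "map_prod left_shift left_shift \<in> measurable \<xi> ?N"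
    using measurable_shift unfolding measurable_cong_sets[OF s refl] map_prod_def
    by measurable
  have step: "measure \<xi> (?D (Suc i)) = measure \<xi> (?D i)" for i
  proof -
    have "measure \<xi> (?D i) = measure (distr \<xi> ?N (map_prod left_shift left_shift)) (?D i)"
      by (simp add: inv)
    also have "\<dots> = measure \<xi> (?D (Suc i))"
      by (subst measure_distr[OF sh D])
         (auto simp: sp left_shift_def intro!: arg_cong[where f = "measure \<xi>"])
    finally show ?thesis by simp
  qed
  have "measure \<xi> (?D i) = measure \<xi> (?D 0)" by (induction i) (simp_all add: step)
  then show ?thesis by (simp add: sp case_prod_unfold)
qed

text \<open>
  The coupling hypothesis is symmetric in the two processes, so one joining bounds the difference of
  the block entropies from both sides.
\<close>

lemma entropy_rate_diff_le:
  fixes \<mu> \<mu>' :: "(nat \<Rightarrow> 'a::finite) measure"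
  assumes b: "b > 1" and d: "0 < d" "d < 1"
    and st: "stationary_law \<mu>" "stationary_law \<mu>'" and dbar: "d_bar \<mu> \<mu>' < d"
  shows "\<bar>entropy_rate b \<mu> - entropy_rate b \<mu>'\<bar> \<le> fano_bound b (real CARD('a)) d"
proof -
  let ?c = "fano_bound b (real CARD('a)) d"
  have "bdd_below ((\<lambda>\<xi>. measure \<xi> {(x, x'). x 0 \<noteq> x' 0}) ` {\<xi>. stationary_joining \<mu> \<mu>' \<xi>})"
    by (intro bdd_belowI[of _ 0]) auto
  moreover have "{\<xi>. stationary_joining \<mu> \<mu>' \<xi>} \<noteq> {}"
    using stationary_joining_pair_measure[OF st] by blast
  ultimately obtain \<xi> where J: "stationary_joining \<mu> \<mu>' \<xi>"
    and lt: "measure \<xi> {(x, x'). x 0 \<noteq> x' 0} < d"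
    using dbar by (auto simp: d_bar_def cINF_less_iff)
  have s: "sets \<xi> = sets (seq_space \<Otimes>\<^sub>M seq_space)" and ps: "prob_space \<xi>"
    and marg: "distr \<xi> seq_space fst = \<mu>" "distr \<xi> seq_space snd = \<mu>'"
    using J by (auto simp: stationary_joining_def)
  have mc: "(\<lambda>z. fst z i) \<in> measurable \<xi> (count_space UNIV)"
    "(\<lambda>z. snd z i) \<in> measurable \<xi> (count_space UNIV)" for i
    unfolding measurable_cong_sets[OF s refl]
    by (rule measurable_compose[OF measurable_fst measurable_coord]
        measurable_compose[OF measurable_snd measurable_coord])+
  have laws: "process_law \<xi> (\<lambda>i z. fst z i) = \<mu>" "process_law \<xi> (\<lambda>i z. snd z i) = \<mu>'"
    using marg by (simp_all add: process_law_def)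
  have close: "measure \<xi> {z \<in> space \<xi>. fst z i \<noteq> snd z i} \<le> d" for i
    using stationary_joining_disagreement[OF J, of i] lt by simp
  then have close': "measure \<xi> {z \<in> space \<xi>. snd z i \<noteq> fst z i} \<le> d" for i
    by (simp add: eq_commute)
  have up: "block_entropy b \<mu> n \<le> block_entropy b \<mu>' n + real n * ?c"
    "block_entropy b \<mu>' n \<le> block_entropy b \<mu> n + real n * ?c" for n
    using block_entropy_le_of_coupling[where X = "\<lambda>i z. fst z i" and Y = "\<lambda>i z. snd z i", OF b d ps mc close]
      block_entropy_le_of_coupling[where X = "\<lambda>i z. snd z i" and Y = "\<lambda>i z. fst z i", OF b d ps mc(2,1) close']
    by (simp_all add: laws)
  have lim: "(\<lambda>n. \<bar>block_entropy b \<mu> n / real n - block_entropy b \<mu>' n / real n\<bar>)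
      \<longlonglongrightarrow> \<bar>entropy_rate b \<mu> - entropy_rate b \<mu>'\<bar>"
    by (intro tendsto_intros block_entropy_tendsto_entropy_rate b st)
  have "\<bar>block_entropy b \<mu> n / real n - block_entropy b \<mu>' n / real n\<bar> \<le> ?c" if "n \<ge> 1" for n
  proof -
    have "\<bar>block_entropy b \<mu> n - block_entropy b \<mu>' n\<bar> / real n \<le> ?c"
      using up[of n] that by (simp add: divide_le_eq abs_le_iff algebra_simps)
    then show ?thesis by (simp add: diff_divide_distrib[symmetric] abs_divide)
  qed
  then show ?thesis by (intro LIMSEQ_le_const2[OF lim]) blast
qed

lemma fano_bound_tendsto_0:
  assumes b: "b > 1" and k: "k > 0"
  shows "((\<lambda>d. fano_bound b k d) \<longlongrightarrow> 0) (at_right 0)"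
  unfolding fano_bound_def log_def using assms by real_asymp

theorem theorem1p3:
  fixes b \<epsilon> :: real
  assumes "b > 1" and "\<epsilon> > 0"
  shows "\<exists>\<delta>>0. \<forall>(\<mu> :: (nat \<Rightarrow> 'a::finite) measure) \<mu>'.
           stationary_law \<mu> \<longrightarrow> stationary_law \<mu>' \<longrightarrow> d_bar \<mu> \<mu>' < \<delta> \<longrightarrow>
           \<bar>entropy_rate b \<mu> - entropy_rate b \<mu>'\<bar> < \<epsilon>"
proof -
  have "\<forall>\<^sub>F d in at_right 0. fano_bound b (real CARD('a)) d < \<epsilon>"
    by (rule order_tendstoD(2)[OF fano_bound_tendsto_0]) (use assms in auto)
  moreover have "\<forall>\<^sub>F d :: real in at_right 0. 0 < d \<and> d < 1"
    by (auto simp: eventually_at_right_field intro!: exI[of _ 1])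
  ultimately have "\<forall>\<^sub>F d in at_right 0. fano_bound b (real CARD('a)) d < \<epsilon> \<and> 0 < d \<and> d < 1"
    by (rule eventually_conj)
  then obtain d where d: "fano_bound b (real CARD('a)) d < \<epsilon>" "0 < d" "d < 1"
    using eventually_happens'[OF trivial_limit_at_right_real] by blast
  show ?thesis
    using entropy_rate_diff_le[OF assms(1) d(2,3), where 'a = 'a] d(1,2)
    by (intro exI[of _ d]) (auto intro: le_less_trans)
qed

end
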